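(* Let $m$ be a positive integer, let $n=2m$ or $n=2m+1$, and let $F(x)=x^{2^{m+1}-1}$ be the power mapping on $\mathbb{F}_{2^n}$. (i) If $n=2m+1$, then $$|\{(a,c,b)\in\mathbb{F}_{2^n}^3:\mathrm{FBDT}_F(a,c,b)=2^n\}|=2^n,$$ $$|\{(a,c,b)\in\mathbb{F}_{2^n}^3:\mathrm{FBDT}_F(a,c,b)=2\}|=2^n(2^n-1),$$ $$|\{(a,c,b)\in\mathbb{F}_{2^n}^3:\mathrm{FBDT}_F(a,c,b)=0\}|=2^{2n}(2^n-1).$$ (ii) If $n=2m$, then $$|\{(a,c,b)\in\mathbb{F}_{2^n}^3:\mathrm{FBDT}_F(a,c,b)=2^n\}|=2^n,$$ $$|\{(a,c,b)\in\mathbb{F}_{2^n}^3:\mathrm{FBDT}_F(a,c,b)=2^m\}|=2^m(2^n-1),$$ $$|\{(a,c,b)\in\mathbb{F}_{2^n}^3:\mathrm{FBDT}_F(a,c,b)=2\}|=(2^n-2^m)(2^n-1),$$ $$|\{(a,c,b)\in\mathbb{F}_{2^n}^3:\mathrm{FBDT}_F(a,c,b)=0\}|=2^{2n}(2^n-1).$$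
   Context: $\mathbb{F}_{2^n}$ is the finite field with $2^n$ elements. For a mapping $F:\mathbb{F}_{2^n}\to\mathbb{F}_{2^n}$ and $(a,c,b)\in\mathbb{F}_{2^n}^3$, the Feistel Boomerang Difference Table (FBDT) entry is $$\mathrm{FBDT}_F(a,c,b)=|\{x\in\mathbb{F}_{2^n}: F(x)+F(x+a)+F(x+b)+F(x+a+b)=0,\ F(x)+F(x+a)=c\}|.$$
   Formalization: In part (ii) with m=1 the values 2^m and 2 coincide and the two printed counts (6 each) are false, the true count being 12; for m=1 these two lines are replaced by the single line giving the sum of the two counts. *)

theory Defs
  imports Complex_Main "HOL-Library.Cardinality"
begin

text \<open>A type of sort \<open>{field, finite}\<close> with \<open>2 ^ n\<close> elements stands for
  the finite field with \<open>2 ^ n\<close> elements.\<close>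

definition FBDT :: "('a::{field, finite} \<Rightarrow> 'a) \<Rightarrow> 'a \<Rightarrow> 'a \<Rightarrow> 'a \<Rightarrow> nat" where
  "FBDT F a c b =
     card {x. F x + F (x + a) + F (x + b) + F (x + a + b) = 0 \<and> F x + F (x + a) = c}"

end

theory Submission
  imports Defs "HOL-Computational_Algebra.Polynomial"
begin

text \<open>
  For \<open>a \<noteq> 0\<close>, the entry at \<open>(a, c, b)\<close> counts the points \<open>x\<close> such that \<open>x\<close> and \<open>x + b\<close> both lie
  in the fibre over \<open>c\<close> of the derivative \<open>D\<^sub>a F x = F x + F (x + a)\<close>, so everything follows from
  the shape of these fibres. Put \<open>Q = 2 ^ (m + 1)\<close>.

  If \<open>n = 2 m + 1\<close>, then \<open>F\<close> is the inverse of the Gold map \<open>y \<mapsto> y ^ (Q + 1)\<close>, and all nonempty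
  fibres have the form \<open>{x, x + a}\<close>.

  If \<open>n = 2 m\<close>, write \<open>x' = x ^ 2 ^ m\<close> for the conjugate over the subfield \<open>K\<close> of order \<open>2 ^ m\<close>.
  Then \<open>F x = x'\<^sup>2 / x\<close> and \<open>D\<^sub>1 F x + 1 = (x + x')\<^sup>2 / (x\<^sup>2 + x)\<close>, so \<open>K\<close> is the fibre over \<open>1\<close>.
  For \<open>x\<close> outside \<open>K\<close>, conjugating and adding shows that \<open>D\<^sub>1 F x\<close> determines the trace
  \<open>x + x'\<close>, hence \<open>x\<^sup>2 + x\<close>, hence the pair \<open>{x, x + 1}\<close>. Since \<open>F\<close> is multiplicative,
  the general \<open>a\<close> reduces to \<open>a = 1\<close>.
\<close>

section \<open>Finite fields and characteristic two\<close>

lemma of_nat_CARD_eq_0: "of_nat CARD('a) = (0::'a::{field, finite})"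
proof -
  \<comment> \<open>Translation by \<open>1\<close> permutes the field, so \<open>1\<close> added
    \<open>CARD('a)\<close> times vanishes.\<close>
  have "(\<Sum>x\<in>UNIV. x + 1) = (\<Sum>x\<in>UNIV. x::'a)"
    by (rule sum.reindex_bij_witness[of _ "\<lambda>x. x - 1" "\<lambda>x. x + 1"]) auto
  then show ?thesis
    by (simp add: sum.distrib)
qed

text \<open>The library states this only for the class \<open>finite_field\<close>, of which the sort
  \<open>{field, finite}\<close> is not an instance.\<close>

lemma power_CARD_eq: "x ^ CARD('a) = (x::'a::{field, finite})"
proof (cases "x = 0")
  case False
  have "(\<Prod>y\<in>-{0}. x * y) = (\<Prod>y\<in>-{0}. y::'a)"
    by (rule prod.reindex_bij_witness[of _ "\<lambda>y. y / x" "\<lambda>y. x * y"]) (use False in auto)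
  then have "x ^ (CARD('a) - 1) = 1"
    by (simp add: prod.distrib Compl_eq_Diff_UNIV)
  then show ?thesis
    using power_eq_if[of x "CARD('a)"] by simp
qed simp

context
  assumes two_eq_0: "2 = (0::'a::field)"
begin

lemma char2_add_self: "x + x = (0::'a)"
  by (metis mult_2 mult_zero_left two_eq_0)

lemma char2_add_cancel: "x + (x + y) = (y::'a)"
  by (simp add: char2_add_self flip: add.assoc)

lemma char2_add_eq_0_iff: "x + y = 0 \<longleftrightarrow> x = (y::'a)"
  by (metis char2_add_cancel add_0_right)

lemmas char2_simps = char2_add_self char2_add_cancel

lemma char2_power_add: "(x + y) ^ 2 ^ k = x ^ 2 ^ k + (y::'a) ^ 2 ^ k"
proof (induction k)
  case (Suc k)
  have "(x + y) ^ 2 ^ Suc k = ((x + y) ^ 2 ^ k)\<^sup>2"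
    by (simp add: mult.commute flip: power_mult)
  then show ?case
    by (simp add: Suc power2_sum two_eq_0 mult.commute flip: power_mult)
qed simp

lemma char2_add_square_eq_iff: "x\<^sup>2 + x = y\<^sup>2 + y \<longleftrightarrow> x = y \<or> x = y + (1::'a)"
proof -
  have "(x + y) * (x + (y + 1)) = (x\<^sup>2 + x) + (y\<^sup>2 + y)"
    by (simp add: algebra_simps power2_eq_square char2_simps)
  then show ?thesis
    by (metis char2_add_eq_0_iff mult_eq_0_iff)
qed
end

section \<open>Table entries from the fibres of the derivative\<close>

text \<open>The hypotheses say that the derivative of \<open>F\<close> in direction \<open>a\<close> is two-to-one outside the
  set \<open>V a\<close>, on which it takes the constant value \<open>F a\<close>.\<close>

lemma FBDT_eq:
  fixes F :: "'a::{field, finite} \<Rightarrow> 'a"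
  assumes two: "2 = (0::'a)" and "a \<noteq> 0"
    and V_add: "\<And>x y. x \<in> V \<Longrightarrow> y \<in> V \<Longrightarrow> x + y \<in> V"
    and const: "\<And>x. F x + F (x + a) = F a \<longleftrightarrow> x \<in> V"
    and inj: "\<And>x y. F x + F (x + a) = F y + F (y + a) \<Longrightarrow> x \<notin> V \<Longrightarrow> y = x \<or> y = x + a"
  shows "FBDT F a c b =
    (if c = F a \<and> b \<in> V then card V
     else if c \<in> (\<lambda>x. F x + F (x + a)) ` (- V) \<and> b \<in> {0, a} then 2 else 0)"
proof -
  note c2 = char2_simps[OF two] char2_add_eq_0_iff[OF two]
  define D where "D x = F x + F (x + a)" for x
  have iff: "F x + F (x + a) + F (x + b) + F (x + a + b) = 0 \<longleftrightarrow> D x = D (x + b)" for x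
    using c2(3)[of "D x" "D (x + b)"] by (simp add: D_def ac_simps)
  have "{x. F x + F (x + a) + F (x + b) + F (x + a + b) = 0 \<and> F x + F (x + a) = c}
      = {x. D x = c \<and> D (x + b) = c}"
    unfolding iff by (auto simp: D_def)
  then have eq: "FBDT F a c b = card {x. D x = c \<and> D (x + b) = c}"
    by (simp add: FBDT_def)
  have D_shift: "D (x + a) = D x" for x
    by (simp add: D_def ac_simps c2)
  have D_const: "D x = F a \<longleftrightarrow> x \<in> V" for x
    using const by (simp add: D_def)
  have D_inj: "D x = D y \<Longrightarrow> x \<notin> V \<Longrightarrow> y = x \<or> y = x + a" for x y
    using inj by (simp add: D_def)
  \<comment> \<open>Every element is its own negative, so translation by a point of \<open>V\<close>
    preserves \<open>V\<close> and its complement.\<close>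
  have V_cancel: "x \<in> V \<Longrightarrow> x + y \<in> V \<longleftrightarrow> y \<in> V" for x y
    using V_add[of x y] V_add[of x "x + y"] by (auto simp: c2)
  consider "c = F a" "b \<in> V" | "c = F a" "b \<notin> V" | "c \<noteq> F a" "c \<notin> D ` (- V)"
    | x where "c \<noteq> F a" "x \<notin> V" "c = D x"
    by blast
  then have "card {x. D x = c \<and> D (x + b) = c} =
    (if c = F a \<and> b \<in> V then card V else if c \<in> D ` (- V) \<and> b \<in> {0, a} then 2 else 0)"
  proof cases
    case 1
    then have "{x. D x = c \<and> D (x + b) = c} = V"
      using V_add by (auto simp: D_const)
    with 1 show ?thesis by simp
  next
    case 2
    then have "{x. D x = c \<and> D (x + b) = c} = {}"
      using V_cancel by (auto simp: D_const)
    moreover have "c \<notin> D ` (- V)"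
      using \<open>c = F a\<close> by (metis ComplD D_const imageE)
    ultimately show ?thesis using 2 by auto
  next
    case 3
    then have "{x. D x = c \<and> D (x + b) = c} = {}"
      by (auto simp: D_const)
    with 3 show ?thesis by simp
  next
    case (4 x)
    then have fibre: "D y = c \<longleftrightarrow> y = x \<or> y = x + a" for y
      using D_inj[of x y] D_shift by auto
    \<comment> \<open>A shift by \<open>b\<close> meets the fibre \<open>{x, x + a}\<close> again
      only for \<open>b \<in> {0, a}\<close>, and then maps it onto itself.\<close>
    have "{y. D y = c \<and> D (y + b) = c} = (if b \<in> {0, a} then {x, x + a} else {})"
      unfolding fibre using \<open>a \<noteq> 0\<close> by (auto simp: add.assoc c2)
    with 4 \<open>a \<noteq> 0\<close> show ?thesis
      by auto
  qed
  then show ?thesis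
    unfolding eq D_def .
qed

text \<open>Outside \<open>V\<close> the fibres are the pairs \<open>{x, x + a}\<close>; no pair
  straddles \<open>V\<close> because \<open>a \<in> V\<close>.\<close>

lemma two_card_image_derivative:
  fixes F :: "'a::{field, finite} \<Rightarrow> 'a"
  assumes two: "2 = (0::'a)" and "a \<noteq> 0"
    and V_self: "a \<in> V"
    and V_add: "\<And>x y. x \<in> V \<Longrightarrow> y \<in> V \<Longrightarrow> x + y \<in> V"
    and inj: "\<And>x y. F x + F (x + a) = F y + F (y + a) \<Longrightarrow> x \<notin> V \<Longrightarrow> y = x \<or> y = x + a"
  shows "2 * card ((\<lambda>x. F x + F (x + a)) ` (- V)) = CARD('a) - card V"
proof -
  note c2 = char2_simps[OF two] char2_add_eq_0_iff[OF two]
  define D where "D x = F x + F (x + a)" for x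
  have "card {x \<in> - V. D x = c} = 2" if c: "c \<in> D ` (- V)" for c
  proof -
    obtain x where x: "x \<notin> V" "c = D x"
      using c by blast
    have "x + a \<notin> V"
      using V_add[of "x + a" a] V_self x by (auto simp: add.assoc c2)
    with x have "{y \<in> - V. D y = c} = {x, x + a}"
      using inj[OF sym] by (auto simp: D_def add.assoc c2 add.commute[of "F (x + a)"])
    with \<open>a \<noteq> 0\<close> show ?thesis by simp
  qed
  then have "card (- V) = 2 * card (D ` (- V))"
    using sum.image_gen[of "- V" "\<lambda>_. 1::nat" D] by simp
  then show ?thesis
    by (simp add: D_def Compl_eq_Diff_UNIV card_Diff_subset)
qed

text \<open>The nonzero entries sit on three disjoint sets of triples: \<open>CARD('a)\<close> on
  \<open>Z\<close>, \<open>N\<close> on \<open>A\<close>, \<open>2\<close> on \<open>B\<close>.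
  These values may coincide, hence a sum of three conditional terms.\<close>

lemma card_FBDT_eq:
  fixes F :: "'a::{field, finite} \<Rightarrow> 'a"
  assumes two: "2 = (0::'a)"
    and V_card: "\<And>a. a \<noteq> 0 \<Longrightarrow> card (V a) = N" and "N > 0"
    and V_self: "\<And>a. a \<noteq> 0 \<Longrightarrow> a \<in> V a"
    and V_add: "\<And>a x y. a \<noteq> 0 \<Longrightarrow> x \<in> V a \<Longrightarrow> y \<in> V a \<Longrightarrow> x + y \<in> V a"
    and const: "\<And>a x. a \<noteq> 0 \<Longrightarrow> F x + F (x + a) = F a \<longleftrightarrow> x \<in> V a"
    and inj: "\<And>a x y. a \<noteq> 0 \<Longrightarrow> F x + F (x + a) = F y + F (y + a) \<Longrightarrow> x \<notin> V a \<Longrightarrow>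
      y = x \<or> y = x + a"
  shows card_FBDT_eq_pos: "v > 0 \<Longrightarrow> card {(a, c, b). FBDT F a c b = v} =
      (if v = CARD('a) then CARD('a) else 0) + (if v = N then N * (CARD('a) - 1) else 0)
      + (if v = 2 then (CARD('a) - N) * (CARD('a) - 1) else 0)"
    and card_FBDT_eq_0:
      "card {(a, c, b). FBDT F a c b = 0} = CARD('a) ^ 2 * (CARD('a) - 1)"
proof -
  define D where "D a x = F x + F (x + a)" for a x
  \<comment> \<open>\<open>Z\<close> comes from the degenerate direction \<open>a = 0\<close>,
    \<open>A\<close> from the fibre over \<open>F a\<close>, \<open>B\<close> from the two-point
    fibres outside \<open>V a\<close>.\<close>
  define Z where "Z = {0::'a} \<times> {0::'a} \<times> (UNIV::'a set)"
  define A where "A = (SIGMA a:-{0}. {F a} \<times> V a)"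
  define B where "B = (SIGMA a:-{0}. D a ` (- V a) \<times> {0, a})"
  have FBDT: "FBDT F a c b =
     (if (a, c, b) \<in> Z then CARD('a) else if (a, c, b) \<in> A then N
      else if (a, c, b) \<in> B then 2 else 0)" for a c b
  proof (cases "a = 0")
    case True
    then show ?thesis
      by (auto simp: Z_def A_def B_def FBDT_def char2_add_self[OF two])
  next
    case False
    note FBDT_eq[of a "V a" F c b, OF two False V_add const inj]
    with False show ?thesis
      by (simp add: Z_def A_def B_def D_def V_card)
  qed
  have AB: "A \<inter> B = {}"
    using const by (force simp: A_def B_def D_def)
  have ZAB: "Z \<inter> (A \<union> B) = {}"
    by (auto simp: Z_def A_def B_def)
  have card_Z: "card Z = CARD('a)"
    by (simp add: Z_def)
  have card_A: "card A = N * (CARD('a) - 1)"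
    by (simp add: A_def V_card Compl_eq_Diff_UNIV card_Diff_subset card_cartesian_product)
  have card_B: "card B = (CARD('a) - N) * (CARD('a) - 1)"
  proof -
    have "card (D a ` (- V a) \<times> {0, a}) = CARD('a) - N" if "a \<noteq> 0" for a
      using two_card_image_derivative[of a "V a" F, OF two that V_self V_add inj] that
      by (simp add: V_card D_def card_cartesian_product)
    then show ?thesis
      by (simp add: B_def Compl_eq_Diff_UNIV card_Diff_subset)
  qed
  show "card {(a, c, b). FBDT F a c b = v} =
      (if v = CARD('a) then CARD('a) else 0) + (if v = N then N * (CARD('a) - 1) else 0)
      + (if v = 2 then (CARD('a) - N) * (CARD('a) - 1) else 0)" if "v > 0"
  proof -
    have "{(a, c, b). FBDT F a c b = v} =
        (if v = CARD('a) then Z else {}) \<union>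
        ((if v = N then A else {}) \<union> (if v = 2 then B else {}))"
      using that AB ZAB by (auto simp: FBDT split: if_splits)
    also have "card \<dots> = card (if v = CARD('a) then Z else {}) +
        (card (if v = N then A else {}) + card (if v = 2 then B else {}))"
      using AB ZAB by (subst card_Un_disjoint; (subst card_Un_disjoint)?) auto
    finally show ?thesis
      by (simp add: card_Z card_A card_B)
  qed
  show "card {(a, c, b). FBDT F a c b = 0} = CARD('a) ^ 2 * (CARD('a) - 1)"
  proof -
    \<comment> \<open>With this bound \<open>N\<close> cancels from \<open>card A + card B\<close>
      despite truncated subtraction.\<close>
    have "N \<le> CARD('a)"
      using card_mono[of UNIV "V 1"] V_card[of 1] by simp
    have "{(a, c, b). FBDT F a c b = 0} = - (Z \<union> (A \<union> B))"
      using \<open>N > 0\<close> by (auto simp: FBDT split: if_splits)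
    also have "card \<dots> = CARD('a) ^ 3 - (card Z + (card A + card B))"
      using AB ZAB by (simp add: Compl_eq_Diff_UNIV card_Diff_subset card_Un_disjoint power3_eq_cube)
    also have "card A + card B = CARD('a) * (CARD('a) - 1)"
      using \<open>N \<le> CARD('a)\<close> by (simp add: card_A card_B flip: add_mult_distrib)
    finally show ?thesis
      by (simp add: card_Z power2_eq_square power3_eq_cube algebra_simps)
  qed
qed

section \<open>Odd \<open>n\<close>: fibres for the inverse of a Gold map\<close>

text \<open>In terms of \<open>F x\<close> the fibre condition is an affine equation, whose
  solutions differ by \<open>c\<close> times a fixed point \<open>r\<close> of
  \<open>x \<mapsto> x ^ 2 ^ k\<close>. By \<open>Q\<close> this map applied twice is squaring, so
  \<open>r\<close> is \<open>0\<close> or \<open>1\<close>.\<close>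

lemma derivative_inverse_Gold:
  fixes F :: "'a::{field, finite} \<Rightarrow> 'a"
  assumes two: "2 = (0::'a)"
    and Q: "\<And>x::'a. (x ^ 2 ^ k) ^ 2 ^ k = x\<^sup>2"
    and F: "\<And>x. F x ^ (2 ^ k + 1) = x"
    and "a \<noteq> 0"
    and eq: "F x + F (x + a) = F y + F (y + a)"
  shows "y = x \<or> y = x + a"
proof -
  note c2 = char2_simps[OF two] char2_add_eq_0_iff[OF two]
  define c where "c = F x + F (x + a)"
  have F_shift: "F (z + a) = F z + c" if "F z + F (z + a) = c" for z
    using that by (auto simp: c2)
  have Gold: "F z ^ 2 ^ k * c + c ^ 2 ^ k * F z + c ^ (2 ^ k + 1) = a"
    if "F z + F (z + a) = c" for z
  proof -
    have "a = (z + a) + z"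
      by (simp add: ac_simps c2)
    also have "\<dots> = (F z + c) ^ (2 ^ k + 1) + F z ^ (2 ^ k + 1)"
      using F[of "z + a"] F[of z] by (simp only: F_shift[OF that])
    also have "\<dots> = F z ^ 2 ^ k * c + c ^ 2 ^ k * F z + c ^ (2 ^ k + 1)"
      by (simp add: char2_power_add[OF two] algebra_simps c2)
    finally show ?thesis ..
  qed
  have "c \<noteq> 0"
    using Gold[of x] \<open>a \<noteq> 0\<close> by (auto simp: c_def)
  define r where "r = (F x + F y) / c"
  have rc: "r * c = F x + F y"
    using \<open>c \<noteq> 0\<close> by (simp add: r_def)
  have "(F x ^ 2 ^ k * c + c ^ 2 ^ k * F x + c ^ (2 ^ k + 1)) +
      (F y ^ 2 ^ k * c + c ^ 2 ^ k * F y + c ^ (2 ^ k + 1)) = 0"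
    using Gold[of x] Gold[of y] eq by (simp add: c_def c2)
  also have "(F x ^ 2 ^ k * c + c ^ 2 ^ k * F x + c ^ (2 ^ k + 1)) +
      (F y ^ 2 ^ k * c + c ^ 2 ^ k * F y + c ^ (2 ^ k + 1)) =
      (F x + F y) ^ 2 ^ k * c + c ^ 2 ^ k * (F x + F y)"
    by (simp add: char2_power_add[OF two] algebra_simps c2)
  also have "\<dots> = c ^ (2 ^ k + 1) * (r ^ 2 ^ k + r)"
    by (simp add: algebra_simps flip: rc)
  finally have "r ^ 2 ^ k = r"
    using \<open>c \<noteq> 0\<close> by (simp add: c2)
  then have "r = r\<^sup>2"
    using Q[of r] by simp
  then consider "r = 0" | "r = 1"
    by (auto simp: power2_eq_square)
  then show ?thesis
  proof cases
    case 1
    then have "F x = F y"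
      using rc by (simp add: c2)
    then show ?thesis
      using F by metis
  next
    case 2
    then have "F y = F (x + a)"
      using rc by (simp add: c_def)
    then show ?thesis
      using F by metis
  qed
qed

section \<open>Even \<open>n\<close>: fibres via conjugation over the subfield\<close>

text \<open>Conjugation fixes the trace \<open>t x\<close> and adds
  \<open>(t x)\<^sup>2 + t x\<close> to \<open>x\<^sup>2 + x\<close>. Comparing the cross-multiplied
  equality of two derivatives with its conjugate leaves
  \<open>(t x)\<^sup>2 * t y = (t y)\<^sup>2 * t x\<close>, so nonzero traces agree.\<close>

lemma derivative_conj_square_div:
  fixes F :: "'a::{field, finite} \<Rightarrow> 'a"
  assumes two: "2 = (0::'a)"
    and conj: "\<And>x::'a. (x ^ 2 ^ m) ^ 2 ^ m = x"
    and F: "\<And>x. F x = (x ^ 2 ^ m)\<^sup>2 / x"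
  shows derivative_conj_square_div_eq_1_iff: "F x + F (x + 1) = 1 \<longleftrightarrow> x ^ 2 ^ m = x"
    and derivative_conj_square_div_inj:
      "F x + F (x + 1) = F y + F (y + 1) \<Longrightarrow> x ^ 2 ^ m \<noteq> x \<Longrightarrow> y = x \<or> y = x + 1"
proof -
  note c2 = char2_simps[OF two] char2_add_eq_0_iff[OF two]
  define t where "t x = x + x ^ 2 ^ m" for x :: 'a
  have t_0: "t x = 0 \<longleftrightarrow> x ^ 2 ^ m = x" for x
    by (auto simp: t_def c2)
  have D: "(F x + F (x + 1) + 1) * (x\<^sup>2 + x) = (t x)\<^sup>2" if "x \<noteq> 0" "x \<noteq> 1" for x
  proof -
    have "x + 1 \<noteq> 0"
      using that by (simp add: c2)
    have "(F x + F (x + 1) + 1) * (x\<^sup>2 + x)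
        = (F x * x) * (x + 1) + (F (x + 1) * (x + 1)) * x + x * (x + 1)"
      by (simp add: algebra_simps power2_eq_square)
    also have "F x * x = (x ^ 2 ^ m)\<^sup>2"
      using that by (simp add: F)
    also have "F (x + 1) * (x + 1) = (x ^ 2 ^ m + 1)\<^sup>2"
      using \<open>x + 1 \<noteq> 0\<close> by (simp add: F char2_power_add[OF two])
    also have "(x ^ 2 ^ m)\<^sup>2 * (x + 1) + (x ^ 2 ^ m + 1)\<^sup>2 * x + x * (x + 1) = (t x)\<^sup>2"
      by (simp add: t_def algebra_simps power2_eq_square c2)
    finally show ?thesis .
  qed
  have u_0: "x\<^sup>2 + x \<noteq> 0" if "x \<noteq> 0" "x \<noteq> 1" for x :: 'a
    using that by (simp add: c2 power2_eq_square)
  show D_1: "F x + F (x + 1) = 1 \<longleftrightarrow> x ^ 2 ^ m = x" for x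
  \<comment> \<open>At these points \<open>x\<^sup>2 + x\<close> vanishes and \<open>D\<close> is
    silent; \<open>F 0 = 0\<close> holds by the convention \<open>0 / 0 = 0\<close>.\<close>
  proof (cases "x = 0 \<or> x = 1")
    case True
    then show ?thesis
      by (auto simp: F char2_add_self[OF two] power_0_left)
  next
    case False
    have "F x + F (x + 1) = 1 \<longleftrightarrow> (F x + F (x + 1) + 1) * (x\<^sup>2 + x) = 0"
      using u_0[of x] False by (simp add: c2(3) del: add_eq_0_iff)
    also have "\<dots> \<longleftrightarrow> t x = 0"
      using D[of x] False by simp
    finally show ?thesis
      by (simp add: t_0)
  qed
  \<comment> \<open>The conjugate of \<open>x\<close> is \<open>x + t x\<close>.\<close>
  have conj_u: "(x\<^sup>2 + x) ^ 2 ^ m = (x\<^sup>2 + x) + ((t x)\<^sup>2 + t x)" for x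
    by (simp add: char2_power_add[OF two] t_def algebra_simps power2_sum two c2
        flip: power_mult)
  have conj_t: "t x ^ 2 ^ m = t x" for x
    by (simp add: t_def char2_power_add[OF two] conj add.commute)
  assume eq: "F x + F (x + 1) = F y + F (y + 1)" and x: "x ^ 2 ^ m \<noteq> x"
  then have y: "y ^ 2 ^ m \<noteq> y"
    using D_1[of x] D_1[of y] by simp
  define u v where "u = x\<^sup>2 + x" and "v = y\<^sup>2 + y"
  have "x \<noteq> 0" "x \<noteq> 1" "y \<noteq> 0" "y \<noteq> 1"
    using x y by (auto simp: power_0_left)
  define d where "d = F x + F (x + 1) + 1"
  have du: "d * u = (t x)\<^sup>2" and dv: "d * v = (t y)\<^sup>2"
    using D[OF \<open>x \<noteq> 0\<close> \<open>x \<noteq> 1\<close>] D[OF \<open>y \<noteq> 0\<close> \<open>y \<noteq> 1\<close>] eq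
    by (simp_all add: d_def u_def v_def)
  have "d \<noteq> 0"
    using du x t_0[of x] by (metis mult_zero_left power_eq_0_iff)
  have "(t x)\<^sup>2 * (d * v) = (t y)\<^sup>2 * (d * u)"
    by (simp add: du dv)
  then have cross: "(t x)\<^sup>2 * v = (t y)\<^sup>2 * u"
    using \<open>d \<noteq> 0\<close> by simp
  then have "((t x)\<^sup>2 * v) ^ 2 ^ m = ((t y)\<^sup>2 * u) ^ 2 ^ m"
    by simp
  moreover have "((t x)\<^sup>2) ^ 2 ^ m = (t x)\<^sup>2" for x
    by (metis conj_t power_mult mult.commute)
  ultimately have "(t x)\<^sup>2 * (v + ((t y)\<^sup>2 + t y)) = (t y)\<^sup>2 * (u + ((t x)\<^sup>2 + t x))"
    by (simp add: power_mult_distrib conj_u u_def v_def)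
  then have "(t x)\<^sup>2 * t y = (t y)\<^sup>2 * t x"
    by (simp add: distrib_left cross)
  then have "t x = t y"
    using x y t_0[of x] t_0[of y] by (simp add: power2_eq_square)
  then have "u = v"
    using cross x t_0[of y] t_0[of x] by simp
  then show "y = x \<or> y = x + 1"
    using char2_add_square_eq_iff[OF two, of y x] by (simp add: u_def v_def)
qed

text \<open>An upper bound from the degree of \<open>p\<close> meets a lower bound from counting
  trace fibres.\<close>

lemma card_fixed_conj:
  assumes two: "2 = (0::'a::{field, finite})"
    and conj: "\<And>x::'a. (x ^ 2 ^ m) ^ 2 ^ m = x"
    and card: "CARD('a) = 2 ^ (2 * m)" and "m > 0"
  shows "card {x::'a. x ^ 2 ^ m = x} = 2 ^ m"
proof -
  note c2 = char2_simps[OF two] char2_add_eq_0_iff[OF two]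
  define K where "K = {x::'a. x ^ 2 ^ m = x}"
  \<comment> \<open>the fibres of the trace \<open>t\<close> into \<open>K\<close> are translates of \<open>K\<close>, so \<open>CARD('a) \<le> (card K)\<^sup>2\<close>\<close>
  define t where "t x = x + x ^ 2 ^ m" for x :: 'a
  have t_add: "t (x + y) = t x + t y" for x y
    by (simp add: t_def char2_power_add[OF two] ac_simps)
  have K_iff: "x \<in> K \<longleftrightarrow> t x = 0" for x
    by (auto simp: K_def t_def c2)
  define p where "p = monom (1::'a) (2 ^ m) + monom 1 1"
  \<comment> \<open>For \<open>m = 0\<close> the two monomials of \<open>p\<close> would cancel;
    \<open>m > 0\<close> makes the first one dominate.\<close>
  have "1 < (2::nat) ^ m"
    by (rule one_less_power) (use \<open>m > 0\<close> in auto)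
  then have "degree p = 2 ^ m"
    unfolding p_def by (subst degree_add_eq_left) (auto simp: degree_monom_eq)
  moreover have "K = {x. poly p x = 0}"
    by (simp add: K_def p_def poly_monom c2)
  ultimately have le: "card K \<le> 2 ^ m"
    using card_poly_roots_bound[of p] by force
  have "t ` UNIV \<subseteq> K"
    by (auto simp: K_def t_def char2_power_add[OF two] conj add.commute)
  then have "card (range t) \<le> card K"
    by (simp add: card_mono)
  moreover have "card {x. t x = s} \<le> card K" for s
  proof (cases "\<exists>y. t y = s")
    case True
    then obtain y where "t y = s" ..
    then have "(\<lambda>x. x + y) ` {x. t x = s} \<subseteq> K"
      by (auto simp: K_iff t_add c2)
    then show ?thesis
      by (rule card_inj_on_le[rotated]) (auto simp: inj_on_def)
  qed simp
  then have "CARD('a) \<le> card (range t) * card K"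
    using sum.image_gen[of UNIV "\<lambda>_. 1::nat" t]
      sum_bounded_above[of "range t" "\<lambda>s. card {x. t x = s}" "card K"] by simp
  ultimately have "CARD('a) \<le> card K * card K"
    by (meson le_trans mult_le_mono1)
  then have "(2 ^ m)\<^sup>2 \<le> (card K)\<^sup>2"
    by (simp add: card power2_eq_square mult_2 power_add)
  then have "2 ^ m \<le> card K"
    using power2_nat_le_eq_le by blast
  with le show ?thesis
    by (simp add: K_def)
qed

section \<open>Counting for both parities of \<open>n\<close>\<close>

text \<open>For even \<open>n\<close> and \<open>m = 1\<close> the values \<open>2 ^ m\<close> and
  \<open>2\<close> coincide, so their two counts add; hence the case distinction on
  \<open>m\<close>.\<close>

theorem proposition3:
  fixes m n :: nat
    and F :: "'a::{field, finite} \<Rightarrow> 'a"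
  assumes "m > 0"
    and "n = 2 * m \<or> n = 2 * m + 1"
    and "CARD('a) = 2 ^ n"
    and "F = (\<lambda>x. x ^ (2 ^ (m + 1) - 1))"
  shows
    "(n = 2 * m + 1 \<longrightarrow>
        card {(a, c, b). FBDT F a c b = 2 ^ n} = 2 ^ n \<and>
        card {(a, c, b). FBDT F a c b = 2} = 2 ^ n * (2 ^ n - 1) \<and>
        card {(a, c, b). FBDT F a c b = 0} = 2 ^ (2 * n) * (2 ^ n - 1)) \<and>
     (n = 2 * m \<longrightarrow>
        card {(a, c, b). FBDT F a c b = 2 ^ n} = 2 ^ n \<and>
        (m \<noteq> 1 \<longrightarrow>
           card {(a, c, b). FBDT F a c b = 2 ^ m} = 2 ^ m * (2 ^ n - 1) \<and>
           card {(a, c, b). FBDT F a c b = 2} = (2 ^ n - 2 ^ m) * (2 ^ n - 1)) \<and>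
        (m = 1 \<longrightarrow>
           card {(a, c, b). FBDT F a c b = 2} =
             2 ^ m * (2 ^ n - 1) + (2 ^ n - 2 ^ m) * (2 ^ n - 1)) \<and>
        card {(a, c, b). FBDT F a c b = 0} = 2 ^ (2 * n) * (2 ^ n - 1))"
proof -
  have "(2::'a) ^ n = 0"
    using of_nat_CARD_eq_0[where ?'a = 'a] by (simp add: assms(3))
  then have two: "2 = (0::'a)"
    by simp
  note c2 = char2_simps[OF two] char2_add_eq_0_iff[OF two]
  have power_n: "x ^ 2 ^ n = x" for x :: 'a
    using power_CARD_eq[of x] assms(3) by simp
  have F_mult: "F (x * y) = F x * F y" for x y
    by (simp add: assms(4) power_mult_distrib)
  have F_0: "F 0 = 0"
    using one_less_power[of "2::nat" "m + 1"] by (simp add: assms(4) power_0_left)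
  have F_nz: "F x \<noteq> 0" if "x \<noteq> 0" for x
    using that by (simp add: assms(4))
  have F_times: "F x * x = x ^ 2 ^ (m + 1)" for x
    by (simp add: assms(4) flip: power_Suc2)
  have "n \<ge> 2" "n > m"
    using assms(1,2) by auto
  \<comment> \<open>The entry \<open>2 ^ n\<close> at \<open>a = c = 0\<close> must collide with
    neither \<open>2\<close> nor \<open>2 ^ m\<close>.\<close>
  then have neq: "(2::nat) ^ n \<noteq> 2" "(2::nat) ^ n \<noteq> 2 ^ m"
    using power_inject_exp[of "2::nat" n 1] by auto
  have odd: "card {(a, c, b). FBDT F a c b = 2 ^ n} = 2 ^ n"
      "card {(a, c, b). FBDT F a c b = 2} = 2 ^ n * (2 ^ n - 1)"
      "card {(a, c, b). FBDT F a c b = 0} = 2 ^ (2 * n) * (2 ^ n - 1)"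
    if n: "n = 2 * m + 1"
  proof -
    have Q: "(x ^ 2 ^ (m + 1)) ^ 2 ^ (m + 1) = x\<^sup>2" for x :: 'a
    proof -
      have "(2::nat) ^ (m + 1) * 2 ^ (m + 1) = 2 ^ n * 2"
        by (simp add: n power_even_eq power2_eq_square)
      then have "(x ^ 2 ^ (m + 1)) ^ 2 ^ (m + 1) = (x ^ 2 ^ n)\<^sup>2"
        by (simp only: flip: power_mult)
      then show ?thesis
        by (simp only: power_n)
    qed
    have F_inv: "F x ^ (2 ^ (m + 1) + 1) = x" for x
    proof (cases "x = 0")
      case False
      \<comment> \<open>Multiplying by \<open>x\<close> produces \<open>F x * x\<close>, itself a
        Frobenius power of \<open>x\<close>, to which \<open>Q\<close> then applies.\<close>
      have "F x ^ (2 ^ (m + 1) + 1) * x = F x ^ 2 ^ (m + 1) * (F x * x)"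
        by (simp only: power_add power_one_right mult.assoc)
      also have "\<dots> = F x ^ 2 ^ (m + 1) * x ^ 2 ^ (m + 1)"
        by (simp only: F_times)
      also have "\<dots> = (F x * x) ^ 2 ^ (m + 1)"
        by (simp only: power_mult_distrib)
      also have "\<dots> = x * x"
        using Q[of x] by (simp only: F_times power2_eq_square)
      finally show ?thesis
        using False by simp
    qed (simp add: F_0)
    have inj: "F x + F (x + a) = F y + F (y + a) \<Longrightarrow> y = x \<or> y = x + a" if "a \<noteq> 0" for a x y
      using derivative_inverse_Gold[OF two Q F_inv that] .
    \<comment> \<open>As \<open>F 0 = 0\<close>, \<open>F a\<close> is the derivative at
      \<open>0\<close>, so \<open>inj\<close> makes \<open>{0, a}\<close> its whole fibre: the case
      \<open>N = 2\<close>, in which \<open>A\<close> and \<open>B\<close> both carry the entry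
      \<open>2\<close>.\<close>
    have const: "F x + F (x + a) = F a \<longleftrightarrow> x \<in> {0, a}" if "a \<noteq> 0" for a x
      using inj[OF that, of 0 x] by (auto simp: F_0 c2)
    note count = card_FBDT_eq[where V = "\<lambda>a. {0, a}" and N = 2 and F = F, OF two _ _ _ _ const inj]
    have pos: "card {(a, c, b). FBDT F a c b = v} =
      (if v = CARD('a) then CARD('a) else 0) + (if v = 2 then 2 * (CARD('a) - 1) else 0)
      + (if v = 2 then (CARD('a) - 2) * (CARD('a) - 1) else 0)" if "v > 0" for v
      by (rule count(1)) (use that in \<open>auto simp: c2\<close>)
    have zero: "card {(a, c, b). FBDT F a c b = 0} = CARD('a) ^ 2 * (CARD('a) - 1)"
      by (rule count(2)) (auto simp: c2)
    have "(2::nat) \<le> 2 ^ n"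
      using power_increasing[of 1 n "2::nat"] \<open>n \<ge> 2\<close> by simp
    then have "2 * (2 ^ n - 1) + (2 ^ n - 2) * (2 ^ n - 1) = 2 ^ n * (2 ^ n - 1 :: nat)"
      by (simp only: le_add_diff_inverse flip: add_mult_distrib)
    then show "card {(a, c, b). FBDT F a c b = 2} = 2 ^ n * (2 ^ n - 1)"
      using pos[of 2] neq by (simp add: assms(3))
    show "card {(a, c, b). FBDT F a c b = 2 ^ n} = 2 ^ n"
      using pos[of "2 ^ n"] neq by (simp add: assms(3))
    show "card {(a, c, b). FBDT F a c b = 0} = 2 ^ (2 * n) * (2 ^ n - 1)"
      using zero by (simp add: assms(3) mult.commute flip: power_mult)
  qed
  have even: "card {(a, c, b). FBDT F a c b = 2 ^ n} = 2 ^ n"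
      "m \<noteq> 1 \<Longrightarrow> card {(a, c, b). FBDT F a c b = 2 ^ m} = 2 ^ m * (2 ^ n - 1)"
      "m \<noteq> 1 \<Longrightarrow> card {(a, c, b). FBDT F a c b = 2} = (2 ^ n - 2 ^ m) * (2 ^ n - 1)"
      "m = 1 \<Longrightarrow> card {(a, c, b). FBDT F a c b = 2} =
             2 ^ m * (2 ^ n - 1) + (2 ^ n - 2 ^ m) * (2 ^ n - 1)"
      "card {(a, c, b). FBDT F a c b = 0} = 2 ^ (2 * n) * (2 ^ n - 1)"
    if n: "n = 2 * m"
  proof -
    have conj: "(x ^ 2 ^ m) ^ 2 ^ m = x" for x :: 'a
    proof -
      have "(2::nat) ^ m * 2 ^ m = 2 ^ n"
        by (simp add: n mult_2 power_add)
      then show ?thesis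
        using power_n[of x] by (simp flip: power_mult)
    qed
    have F_div: "F x = (x ^ 2 ^ m)\<^sup>2 / x" for x
    proof -
      have "F x * x = (x ^ 2 ^ m)\<^sup>2"
        using F_times[of x] by (metis Suc_eq_plus1 power_Suc2 power_mult)
      then show ?thesis
        using F_0 by (cases "x = 0") (auto simp: eq_divide_eq)
    qed
    \<comment> \<open>For \<open>a \<noteq> 0\<close> this is \<open>a\<close> times the subfield
      fixed by conjugation; multiplicativity of \<open>F\<close> carries direction \<open>1\<close>
      to direction \<open>a\<close>.\<close>
    define V where "V a = {x::'a. (x / a) ^ 2 ^ m = x / a}" for a
    have D: "F x + F (x + a) = F a * (F (x / a) + F (x / a + 1))" if "a \<noteq> 0" for a x
      using F_mult[of a "x / a"] F_mult[of a "x / a + 1"] that by (simp add: distrib_left)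
    have const: "F x + F (x + a) = F a \<longleftrightarrow> x \<in> V a" if "a \<noteq> 0" for a x
      using derivative_conj_square_div_eq_1_iff[OF two conj F_div, of "x / a"] F_nz[OF that]
      by (simp add: D[OF that] V_def)
    have inj: "y = x \<or> y = x + a"
      if "a \<noteq> 0" "F x + F (x + a) = F y + F (y + a)" "x \<notin> V a" for a x y
    proof -
      have "y / a = x / a \<or> y / a = x / a + 1"
        using derivative_conj_square_div_inj[OF two conj F_div, of "x / a" "y / a"] F_nz[of a] that
        by (simp add: D[OF \<open>a \<noteq> 0\<close>] V_def)
      then show ?thesis
        using \<open>a \<noteq> 0\<close> by (auto simp: field_simps)
    qed
    have V_card: "card (V a) = 2 ^ m" if "a \<noteq> 0" for a
    proof -
      have "V a = (*) a ` {x. x ^ 2 ^ m = x}"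
        using that by (auto simp: V_def intro!: image_eqI[of _ _ "_ / a"])
      then show ?thesis
        using card_fixed_conj[OF two conj] assms(1,3) n that
        by (simp add: card_image inj_on_def)
    qed
    have V_add: "x + y \<in> V a" if "x \<in> V a" "y \<in> V a" for a x y
      using that by (simp add: V_def add_divide_distrib char2_power_add[OF two])
    have V_self: "a \<in> V a" if "a \<noteq> 0" for a
      using that by (simp add: V_def)
    note count = card_FBDT_eq[where V = V and N = "2 ^ m" and F = F,
        OF two V_card _ V_self V_add const inj]
    have pos: "card {(a, c, b). FBDT F a c b = v} =
      (if v = CARD('a) then CARD('a) else 0) + (if v = 2 ^ m then 2 ^ m * (CARD('a) - 1) else 0)
      + (if v = 2 then (CARD('a) - 2 ^ m) * (CARD('a) - 1) else 0)" if "v > 0" for v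
      by (rule count(1)) (use that in auto)
    have zero: "card {(a, c, b). FBDT F a c b = 0} = CARD('a) ^ 2 * (CARD('a) - 1)"
      by (rule count(2)) auto
    have neq': "(2::nat) ^ m \<noteq> 2" if "m \<noteq> 1"
      using power_inject_exp[of "2::nat" m 1] that by simp
    show "card {(a, c, b). FBDT F a c b = 2 ^ n} = 2 ^ n"
      using pos[of "2 ^ n"] neq by (simp add: assms(3))
    show "card {(a, c, b). FBDT F a c b = 2 ^ m} = 2 ^ m * (2 ^ n - 1)" if "m \<noteq> 1"
      using pos[of "2 ^ m"] neq neq' that by (simp add: assms(3))
    show "card {(a, c, b). FBDT F a c b = 2} = (2 ^ n - 2 ^ m) * (2 ^ n - 1)" if "m \<noteq> 1"
      using pos[of 2] neq neq' that by (simp add: assms(3))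
    show "card {(a, c, b). FBDT F a c b = 2} =
        2 ^ m * (2 ^ n - 1) + (2 ^ n - 2 ^ m) * (2 ^ n - 1)" if "m = 1"
      using pos[of 2] neq that by (simp add: assms(3))
    show "card {(a, c, b). FBDT F a c b = 0} = 2 ^ (2 * n) * (2 ^ n - 1)"
      using zero by (simp add: assms(3) mult.commute flip: power_mult)
  qed
  show ?thesis
    using odd even by blast
qed

end
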